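(* For every instance of the sortition problem that has at least one panel, the algorithm MaxEntropy (defined in the context) outputs a uniformly random panel: for every panel $P\in\mathcal P$, the probability that MaxEntropy outputs $P$ equals $1/|\mathcal P|$.
   Context: Sortition instance: pool members $N=\{1,\dots,n\}$; a finite nonempty set $F$ of features, each a function $f:N\to V_f$ to a finite set of values; $FV=\{(f,v): f\in F, v\in V_f\}$; a panel size $k$; integer quotas $0\le \ell_{f,v}\le u_{f,v}\le k$ for $(f,v)\in FV$. A panel is a set $P\subseteq N$ with $|P|=k$ and $\ell_{f,v}\le|\{i\in P: f(i)=v\}|\le u_{f,v}$ for all $(f,v)\in FV$; $\mathcal P$ is the set of panels. For a nonempty $F'\subseteq F$ let $FV'=\{(f,v)\in FV: f\in F'\}$, let $w'(i)\in\{0,1\}^{FV'}$ be given by $w'(i)_{f,v}=1$ if $f(i)=v$ and $0$ otherwise, and $w'(U)=\sum_{i\in U}w'(i)$ for $U\subseteq N$. Fix some $f_0\in F'$ and let $\overline{\mathcal Z}'$ be the set of $z\in\mathbb N^{FV'}$ (with $0\in\mathbb N$) with $\ell_{f,v}\le z_{f,v}\le u_{f,v}$ for all $(f,v)\in FV'$ and $\sum_{v\in V_{f_0}}z_{f_0,v}=k$. For $i\in\{1,\dots,n+1\}$ and $z\in\mathbb N^{FV'}$ let $\varphi'(i,z)=|\{U\subseteq\{i,\dots,n\}: z+w'(U)\in\overline{\mathcal Z}'\}|$. Sampler for $F'$: start with $(i,z)=(1,\vec 0)$ and an empty set. At state $(i,z)$ with $i\le n$, with probability $\varphi'(i+1,z+w'(i))/\varphi'(i,z)$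 add $i$ to the set and move to state $(i+1,z+w'(i))$; otherwise do not add $i$ and move to $(i+1,z)$. At $i=n+1$, return the set. MaxEntropy: in rounds $t=1,2,\dots$, a nonempty feature subset $F_t\subseteq F$ is chosen (possibly depending on the sets drawn in earlier rounds), and the sampler for $F_t$ is run with fresh independent randomness, giving a set $P_t$. The algorithm stops at the first round in which $P_t\in\mathcal P$ (that is, $P_t$ satisfies the quotas of all features) and outputs this $P_t$. *)

theory Defs
  imports "HOL-Probability.SPMF"
begin

(* All features share one value type 'v; the value set of f is values I f.  Quotas are
   natural numbers, so nonnegativity is implicit.  Only the restriction of a feature to
   the pool is relevant. *)
record 'v sortition =
  pool_size :: nat
  features :: "(nat \<Rightarrow> 'v) set"
  "values" :: "(nat \<Rightarrow> 'v) \<Rightarrow> 'v set"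
  panel_size :: nat
  lower :: "(nat \<Rightarrow> 'v) \<times> 'v \<Rightarrow> nat"
  upper :: "(nat \<Rightarrow> 'v) \<times> 'v \<Rightarrow> nat"

definition pool :: "'v sortition \<Rightarrow> nat set" where
  "pool I = {1..pool_size I}"

definition feature_values ::
    "'v sortition \<Rightarrow> (nat \<Rightarrow> 'v) set \<Rightarrow> ((nat \<Rightarrow> 'v) \<times> 'v) set" where
  "feature_values I F' = (SIGMA f:F'. values I f)"

definition sortition_instance :: "'v sortition \<Rightarrow> bool" where
  "sortition_instance I \<longleftrightarrow>
     finite (features I) \<and> features I \<noteq> {} \<and>
     (\<forall>f\<in>features I. finite (values I f) \<and> f \<in> pool I \<rightarrow> values I f) \<and>
     (\<forall>p\<in>feature_values I (features I). lower I p \<le> upper I p \<and> upper I p \<le> panel_size I)"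

definition panels :: "'v sortition \<Rightarrow> nat set set" where
  "panels I =
     {P. P \<subseteq> pool I \<and> card P = panel_size I \<and>
         (\<forall>(f, v)\<in>feature_values I (features I).
            lower I (f, v) \<le> card {i\<in>P. f i = v} \<and> card {i\<in>P. f i = v} \<le> upper I (f, v))}"

(* Vectors indexed by feature_values I F' are encoded as functions on all pairs that
   vanish outside feature_values I F'. *)

definition weight ::
    "'v sortition \<Rightarrow> (nat \<Rightarrow> 'v) set \<Rightarrow> nat \<Rightarrow> ((nat \<Rightarrow> 'v) \<times> 'v \<Rightarrow> nat)" where
  "weight I F' i = (\<lambda>(f, v). if (f, v) \<in> feature_values I F' \<and> f i = v then 1 else 0)"

definition set_weight ::
    "'v sortition \<Rightarrow> (nat \<Rightarrow> 'v) set \<Rightarrow> nat set \<Rightarrow> ((nat \<Rightarrow> 'v) \<times> 'v \<Rightarrow> nat)" where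
  "set_weight I F' U = (\<lambda>p. \<Sum>i\<in>U. weight I F' i p)"

definition target_vectors ::
    "'v sortition \<Rightarrow> (nat \<Rightarrow> 'v) set \<Rightarrow> (nat \<Rightarrow> 'v) \<Rightarrow> ((nat \<Rightarrow> 'v) \<times> 'v \<Rightarrow> nat) set" where
  "target_vectors I F' f0 =
     {z. (\<forall>p. p \<notin> feature_values I F' \<longrightarrow> z p = 0) \<and>
         (\<forall>p\<in>feature_values I F'. lower I p \<le> z p \<and> z p \<le> upper I p) \<and>
         (\<Sum>v\<in>values I f0. z (f0, v)) = panel_size I}"

definition completions ::
    "'v sortition \<Rightarrow> (nat \<Rightarrow> 'v) set \<Rightarrow> (nat \<Rightarrow> 'v) \<Rightarrow> nat \<Rightarrow> ((nat \<Rightarrow> 'v) \<times> 'v \<Rightarrow> nat) \<Rightarrow> nat" where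
  "completions I F' f0 i z =
     card {U. U \<subseteq> {i..pool_size I} \<and> (\<lambda>p. z p + set_weight I F' U p) \<in> target_vectors I F' f0}"

(* S is the set built so far.  States with completions I F' f0 i z = 0, where the
   transition probability would be undefined, have probability 0 if I has a panel. *)
function sampler_from ::
    "'v sortition \<Rightarrow> (nat \<Rightarrow> 'v) set \<Rightarrow> (nat \<Rightarrow> 'v) \<Rightarrow> nat \<Rightarrow> ((nat \<Rightarrow> 'v) \<times> 'v \<Rightarrow> nat) \<Rightarrow>
       nat set \<Rightarrow> nat set pmf" where
  "sampler_from I F' f0 i z S =
     (if i \<le> pool_size I then
        let z' = (\<lambda>p. z p + weight I F' i p) in
        bind_pmf
          (bernoulli_pmf (real (completions I F' f0 (i + 1) z') / real (completions I F' f0 i z)))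
          (\<lambda>b. if b then sampler_from I F' f0 (i + 1) z' (insert i S)
               else sampler_from I F' f0 (i + 1) z S)
      else return_pmf S)"
  by auto
termination
  by (relation "Wellfounded.measure (\<lambda>(I, F', f0, i, z, S). pool_size I + 1 - i)") auto

declare sampler_from.simps [simp del]

definition sampler ::
    "'v sortition \<Rightarrow> (nat \<Rightarrow> 'v) set \<Rightarrow> (nat \<Rightarrow> 'v) \<Rightarrow> nat set pmf" where
  "sampler I F' f0 = sampler_from I F' f0 1 (\<lambda>_. 0) {}"

type_synonym 'v history = "((nat \<Rightarrow> 'v) set \<times> nat set) list"

(* The history h lists the pairs (F_t, P_t) of the earlier rounds in chronological order.
   pick h is the distribution of the next feature subset; a deterministic rule is the
   case of a point mass.  anchor F' is the feature f_0 fixed for F'.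
   Being the least fixed point, max_entropy gives the output distribution, the probability
   of never stopping being the mass missing from 1. *)
partial_function (spmf) max_entropy ::
    "'v sortition \<Rightarrow> ((nat \<Rightarrow> 'v) set \<Rightarrow> (nat \<Rightarrow> 'v)) \<Rightarrow>
       ('v history \<Rightarrow> (nat \<Rightarrow> 'v) set pmf) \<Rightarrow> 'v history \<Rightarrow> nat set spmf" where
  "max_entropy I anchor pick h =
     bind_spmf (spmf_of_pmf (pick h)) (\<lambda>F'.
       bind_spmf (spmf_of_pmf (sampler I F' (anchor F'))) (\<lambda>P.
         if P \<in> panels I then return_spmf P
         else max_entropy I anchor pick (h @ [(F', P)])))"

end

theory Submission imports Defs begin

text \<open>
  The transition probabilities are chosen so that their product along the run returning \<open>U\<close>
  telescopes to one over the number of sets the sampler may return. So each sampler gives all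
  panels the same probability, which is at least \<open>2\<close> to the power \<open>- n\<close>. Hence the
  probability of outputting \<open>P\<close>, as a function of the history, and the constant \<open>1 / card (panels I)\<close>
  are both bounded solutions of the one-round recursion, which is a contraction in the
  supremum norm because every round stops with probability bounded away from \<open>0\<close>.
\<close>

section \<open>Completion sets and their recursion\<close>

definition completion_sets ::
    "'v sortition \<Rightarrow> (nat \<Rightarrow> 'v) set \<Rightarrow> (nat \<Rightarrow> 'v) \<Rightarrow> nat \<Rightarrow> ((nat \<Rightarrow> 'v) \<times> 'v \<Rightarrow> nat) \<Rightarrow> nat set set"
  where "completion_sets I F' f0 i z =
     {U. U \<subseteq> {i..pool_size I} \<and> (\<lambda>p. z p + set_weight I F' U p) \<in> target_vectors I F' f0}"

lemma completions_eq_card: "completions I F' f0 i z = card (completion_sets I F' f0 i z)"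
  by (simp add: completions_def completion_sets_def)

lemma completion_sets_subset: "completion_sets I F' f0 i z \<subseteq> Pow {i..pool_size I}"
  by (auto simp: completion_sets_def)

lemma finite_completion_sets [simp]: "finite (completion_sets I F' f0 i z)"
  using completion_sets_subset by (rule finite_subset) simp

text \<open>Since \<open>i\<close> is not in \<open>U\<close>, its weight may be counted either in
  the set or in the current vector \<open>z\<close>.\<close>

lemma insert_in_completion_sets_iff:
  assumes "i \<le> pool_size I" "U \<subseteq> {i+1..pool_size I}"
  shows "insert i U \<in> completion_sets I F' f0 i z \<longleftrightarrow>
         U \<in> completion_sets I F' f0 (i+1) (\<lambda>p. z p + weight I F' i p)"
proof -
  have "i \<notin> U" "finite U"
    using assms(2) finite_subset by auto
  moreover have "insert i U \<subseteq> {i..pool_size I}"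
    using assms by fastforce
  ultimately show ?thesis
    using assms(2) by (simp add: completion_sets_def set_weight_def add.assoc)
qed

lemma in_completion_sets_Suc_iff:
  assumes "U \<subseteq> {i+1..pool_size I}"
  shows "U \<in> completion_sets I F' f0 i z \<longleftrightarrow> U \<in> completion_sets I F' f0 (i+1) z"
proof -
  have "U \<subseteq> {i..pool_size I}"
    using assms by fastforce
  then show ?thesis
    using assms by (simp add: completion_sets_def)
qed

lemma completion_sets_step:
  assumes "i \<le> pool_size I"
  shows "completion_sets I F' f0 i z =
     insert i ` completion_sets I F' f0 (i+1) (\<lambda>p. z p + weight I F' i p) \<union>
     completion_sets I F' f0 (i+1) z" (is "?A = insert i ` ?B \<union> ?C")
proof (intro equalityI subsetI)
  fix U assume U: "U \<in> ?A"
  then have sub: "U \<subseteq> {i..pool_size I}"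
    using completion_sets_subset by blast
  have sub': "U - {i} \<subseteq> {i+1..pool_size I}"
  proof
    fix x assume "x \<in> U - {i}"
    then show "x \<in> {i+1..pool_size I}" using sub by (fastforce simp: Suc_le_eq)
  qed
  show "U \<in> insert i ` ?B \<union> ?C"
  proof (cases "i \<in> U")
    case True
    then have "insert i (U - {i}) \<in> ?A" using U by (simp add: insert_absorb)
    then have "U - {i} \<in> ?B"
      using insert_in_completion_sets_iff[OF assms sub'] by blast
    then show ?thesis using True by (metis UnI1 imageI insert_Diff)
  next
    case False
    then show ?thesis using U in_completion_sets_Suc_iff sub' by (metis Diff_insert0 Diff_empty UnI2)
  qed
next
  fix U assume "U \<in> insert i ` ?B \<union> ?C"
  then show "U \<in> ?A"
  proof
    assume "U \<in> insert i ` ?B"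
    then obtain W where W: "U = insert i W" "W \<in> ?B" by blast
    then have "W \<subseteq> {i+1..pool_size I}"
      using completion_sets_subset by blast
    then show ?thesis
      using insert_in_completion_sets_iff[OF assms] W by simp
  next
    assume "U \<in> ?C"
    moreover from this have "U \<subseteq> {i+1..pool_size I}"
      using completion_sets_subset by blast
    ultimately show ?thesis
      using in_completion_sets_Suc_iff by blast
  qed
qed

text \<open>Splitting by whether \<open>i\<close> is a member gives a disjoint union. If the left
  side is positive, the two summands are the numerators of the two transition probabilities at
  \<open>i\<close>, so the coin bias is at most 1.\<close>

lemma completions_step:
  assumes "i \<le> pool_size I"
  shows "completions I F' f0 i z =
     completions I F' f0 (i+1) (\<lambda>p. z p + weight I F' i p) + completions I F' f0 (i+1) z"
proof -
  let ?B = "completion_sets I F' f0 (i+1) (\<lambda>p. z p + weight I F' i p)"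
  let ?C = "completion_sets I F' f0 (i+1) z"
  have notin: "i \<notin> U" if "U \<in> ?B \<union> ?C" for U
    using that completion_sets_subset by fastforce
  then have "inj_on (insert i) ?B"
    by (auto intro!: inj_onI simp: insert_ident)
  moreover have "insert i ` ?B \<inter> ?C = {}"
    using notin by blast
  ultimately show ?thesis
    by (simp add: completions_eq_card completion_sets_step[OF assms] card_Un_disjoint card_image)
qed

section \<open>Output distribution of the sampler\<close>

lemma set_pmf_sampler_from:
  assumes "P \<in> set_pmf (sampler_from I F' f0 i z S)"
  shows "\<exists>U\<subseteq>{i..pool_size I}. P = S \<union> U"
  using assms
proof (induction I F' f0 i z S rule: sampler_from.induct)
  case (1 I F' f0 i z S)
  let ?z' = "\<lambda>p. z p + weight I F' i p"
  let ?p = "bernoulli_pmf (real (completions I F' f0 (i+1) ?z') / real (completions I F' f0 i z))"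
  show ?case
  proof (cases "i \<le> pool_size I")
    case True
    obtain b where b: "b \<in> set_pmf ?p" "P \<in> set_pmf (if b then sampler_from I F' f0 (i+1) ?z' (insert i S)
        else sampler_from I F' f0 (i+1) z S)"
      using "1.prems" True by (subst (asm) sampler_from.simps) (auto simp: Let_def)
    show ?thesis
    proof (cases b)
      case b_True: True
      then have "b = True" by simp
      note a = b[unfolded this if_True]
      then obtain U where U: "U \<subseteq> {i+1..pool_size I}" "P = insert i S \<union> U"
        using "1.IH"(1)[OF True refl a(1) TrueI a(2)] by auto
      then have "insert i U \<subseteq> {i..pool_size I}" "P = S \<union> insert i U"
        using True by fastforce+
      then show ?thesis by blast
    next
      case b_False: False
      then have "b = False" by simp
      note a = b[unfolded this if_False]
      then obtain U where U: "U \<subseteq> {i+1..pool_size I}" "P = S \<union> U"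
        using "1.IH"(2)[OF True refl a(1) _ a(2)] by auto
      then have "U \<subseteq> {i..pool_size I}" by fastforce
      then show ?thesis using U by blast
    qed
  next
    case False
    then show ?thesis using "1.prems" by (subst (asm) sampler_from.simps) auto
  qed
qed

text \<open>A step from a state with \<open>c\<close> completions to one with \<open>a\<close> has
  probability \<open>a / c\<close>, and the induction hypothesis supplies \<open>1 / a\<close>. As
  \<open>S\<close> has no element from \<open>i\<close> on, membership of \<open>i\<close> in
  \<open>S \<union> U\<close> is decided by \<open>U\<close>, so only one branch can return this
  set.\<close>

lemma pmf_sampler_from:
  assumes "U \<in> completion_sets I F' f0 i z" "S \<inter> {i..} = {}"
  shows "pmf (sampler_from I F' f0 i z S) (S \<union> U) = 1 / completions I F' f0 i z"
  using assms
proof (induction I F' f0 i z S arbitrary: U rule: sampler_from.induct)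
  case (1 I F' f0 i z S)
  let ?z' = "\<lambda>p. z p + weight I F' i p"
  have sub: "U \<subseteq> {i..pool_size I}"
    using "1.prems"(1) completion_sets_subset by blast
  show ?case
  proof (cases "i \<le> pool_size I")
    case True
    let ?a = "real (completions I F' f0 (i+1) ?z')" and ?b = "real (completions I F' f0 (i+1) z)"
    let ?X = "sampler_from I F' f0 (i+1) ?z' (insert i S)" and ?Y = "sampler_from I F' f0 (i+1) z S"
    define c where "c = real (completions I F' f0 i z)"
    have c: "c = ?a + ?b"
      using completions_step[OF True, of F' f0 z] by (simp add: c_def)
    have "c > 0"
      using "1.prems"(1) by (auto simp: c_def completions_eq_card card_gt_0_iff)
    have p01: "0 \<le> ?a / c" "?a / c \<le> 1"
      using c \<open>c > 0\<close> by (auto simp: field_simps)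
    let ?p = "bernoulli_pmf (?a / real (completions I F' f0 i z))"
    have notin: "i \<notin> S" using "1.prems"(2) by auto
    have eq: "pmf (sampler_from I F' f0 i z S) (S \<union> U) =
        ?a / c * pmf ?X (S \<union> U) + (1 - ?a / c) * pmf ?Y (S \<union> U)"
      using True p01
      by (subst sampler_from.simps) (simp add: Let_def pmf_bind c_def[symmetric])
    show ?thesis
    proof (cases "i \<in> U")
      case iU: True
      define W where "W = U - {i}"
      have UW: "U = insert i W" using iU by (auto simp: W_def)
      have "W \<subseteq> {i+1..pool_size I}"
      proof
        fix x assume "x \<in> W"
        then show "x \<in> {i+1..pool_size I}" using sub by (fastforce simp: W_def Suc_le_eq)
      qed
      then have W: "W \<in> completion_sets I F' f0 (i+1) ?z'"
        using insert_in_completion_sets_iff[OF True] "1.prems"(1) UW by blast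
      have a: "?a > 0"
        using W by (auto simp: completions_eq_card card_gt_0_iff)
      \<comment> \<open>The induction hypothesis for a branch is conditional on the coin value lying
        in its support, which follows from \<open>?a > 0\<close>.\<close>
      then have "True \<in> set_pmf ?p"
        using p01 \<open>c > 0\<close> by (simp add: set_pmf_iff flip: c_def)
      moreover have "insert i S \<inter> {i+1..} = {}"
        using "1.prems"(2) by fastforce
      ultimately have "pmf ?X (insert i S \<union> W) = 1 / ?a"
        by (intro "1.IH"(1)[OF True refl _ TrueI W])
      then have X: "pmf ?X (S \<union> U) = 1 / ?a" using UW by simp
      \<comment> \<open>A run that skips \<open>i\<close> can add only larger elements
        later.\<close>
      have "S \<union> U \<notin> set_pmf ?Y"
      proof
        assume "S \<union> U \<in> set_pmf ?Y"
        from set_pmf_sampler_from[OF this]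
        obtain V where V: "V \<subseteq> {i+1..pool_size I}" "S \<union> U = S \<union> V"
          by blast
        then have "i \<in> V" using iU notin by blast
        then show False using V(1) by auto
      qed
      then have "pmf ?Y (S \<union> U) = 0" by (simp add: pmf_eq_0_set_pmf)
      then show ?thesis
        using a unfolding eq X by simp (simp add: c_def)
    next
      case iU: False
      have sub': "U \<subseteq> {i+1..pool_size I}"
      proof
        fix x assume "x \<in> U"
        then have "x \<noteq> i" using iU by blast
        then show "x \<in> {i+1..pool_size I}" using sub \<open>x \<in> U\<close> by (fastforce simp: Suc_le_eq)
      qed
      then have U: "U \<in> completion_sets I F' f0 (i+1) z"
        using in_completion_sets_Suc_iff "1.prems"(1) by blast
      have b: "?b > 0"
        using U by (auto simp: completions_eq_card card_gt_0_iff)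
      have q: "1 - ?a / c = ?b / c"
        using c \<open>c > 0\<close> by (simp add: field_simps)
      have "False \<in> set_pmf ?p"
        using p01 q b \<open>c > 0\<close> by (simp add: set_pmf_iff flip: c_def)
      moreover have "S \<inter> {i+1..} = {}"
        using "1.prems"(2) by fastforce
      ultimately have "pmf ?Y (S \<union> U) = 1 / ?b"
        by (intro "1.IH"(2)[OF True refl _ _ U]) auto
      moreover have "S \<union> U \<notin> set_pmf ?X"
      proof
        assume "S \<union> U \<in> set_pmf ?X"
        from set_pmf_sampler_from[OF this]
        obtain V where "S \<union> U = insert i S \<union> V" by blast
        then show False using iU notin by blast
      qed
      ultimately have "pmf ?Y (S \<union> U) = 1 / ?b" "pmf ?X (S \<union> U) = 0"
        by (simp_all add: pmf_eq_0_set_pmf)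
      then show ?thesis
        using b unfolding eq q by simp (simp add: c_def)
    qed
  next
    case False
    \<comment> \<open>Past the end of the pool the empty set is the only completion, so the count is
      1 and the point mass at \<open>S\<close> agrees.\<close>
    then have "U = {}" using sub by auto
    moreover from this have "completion_sets I F' f0 i z = {{}}"
      using "1.prems"(1) False completion_sets_subset[of I F' f0 i z] by auto
    ultimately show ?thesis
      using False by (subst sampler_from.simps) (simp add: completions_eq_card)
  qed
qed

section \<open>Panels as outputs of the sampler\<close>

lemma set_weight_apply:
  assumes "finite U"
  shows "set_weight I F' U (f, v) =
    (if (f, v) \<in> feature_values I F' then card {i\<in>U. f i = v} else 0)"
  using assms by (simp add: set_weight_def weight_def card_eq_sum sum.inter_filter del: sum_constant One_nat_def)

text \<open>Passing to fewer features only drops quotas. The size condition survives because each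
  member of a panel has exactly one value of \<open>f0\<close>, so the entries at \<open>f0\<close>
  sum to the size of the panel.\<close>

lemma panels_subset_completion_sets:
  assumes "sortition_instance I" "F' \<subseteq> features I" "f0 \<in> F'"
  shows "panels I \<subseteq> completion_sets I F' f0 1 (\<lambda>_. 0)"
proof
  fix P assume P: "P \<in> panels I"
  then have sub: "P \<subseteq> {1..pool_size I}" by (auto simp: panels_def pool_def)
  then have fin: "finite P" by (rule finite_subset) simp
  have f0: "finite (values I f0)" "f0 ` P \<subseteq> values I f0"
    using assms sub by (auto simp: sortition_instance_def pool_def)
  have FV: "feature_values I F' \<subseteq> feature_values I (features I)"
    using assms(2) by (auto simp: feature_values_def)
  have "(\<Sum>v\<in>values I f0. set_weight I F' P (f0, v)) = (\<Sum>v\<in>values I f0. card {i\<in>P. f0 i = v})"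
    using assms(3) by (intro sum.cong) (auto simp: set_weight_apply[OF fin] feature_values_def)
  also have "\<dots> = card P"
    using sum.group[OF fin f0(1) f0(2), of "\<lambda>_. 1::nat"] by simp
  also have "\<dots> = panel_size I" using P by (simp add: panels_def)
  finally show "P \<in> completion_sets I F' f0 1 (\<lambda>_. 0)"
    using sub P FV
    by (fastforce simp: completion_sets_def target_vectors_def set_weight_apply[OF fin] panels_def)
qed

text \<open>The right side does not involve \<open>P\<close>: all panels are equally likely,
  although other sets may be returned too.\<close>

lemma pmf_sampler_panel:
  assumes "sortition_instance I" "F' \<subseteq> features I" "f0 \<in> F'" "P \<in> panels I"
  shows "pmf (sampler I F' f0) P = 1 / completions I F' f0 1 (\<lambda>_. 0)"
  using pmf_sampler_from[of P I F' f0 1 "\<lambda>_. 0" "{}"] panels_subset_completion_sets[OF assms(1-3)] assms(4)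
  by (auto simp: sampler_def)

lemma completions_le: "completions I F' f0 1 z \<le> 2 ^ pool_size I"
  using card_mono[OF _ completion_sets_subset[of I F' f0 1 z]]
  by (simp add: completions_eq_card card_Pow)

text \<open>The completions are subsets of the pool, and the panel makes their number positive, so
  the reciprocal is not the default \<open>1 / 0 = 0\<close>. The bound is uniform in
  \<open>F'\<close>, which gives one contraction factor for all rounds.\<close>

lemma pmf_sampler_panel_ge:
  assumes "sortition_instance I" "F' \<subseteq> features I" "f0 \<in> F'" "P \<in> panels I"
  shows "pmf (sampler I F' f0) P \<ge> 1 / 2 ^ pool_size I"
proof -
  have "0 < completions I F' f0 1 (\<lambda>_. 0)"
    using panels_subset_completion_sets[OF assms(1-3)] assms(4)
    by (auto simp: completions_eq_card card_gt_0_iff)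
  moreover have "real (completions I F' f0 1 (\<lambda>_. 0)) \<le> 2 ^ pool_size I"
    using completions_le[of I F' f0 "\<lambda>_. 0"] by (metis of_nat_le_iff of_nat_numeral of_nat_power)
  ultimately show ?thesis
    by (simp add: pmf_sampler_panel[OF assms] frac_le)
qed

lemma set_pmf_sampler: "set_pmf (sampler I F' f0) \<subseteq> Pow (pool I)"
proof
  fix P assume "P \<in> set_pmf (sampler I F' f0)"
  from set_pmf_sampler_from[OF this[unfolded sampler_def]] show "P \<in> Pow (pool I)"
    by (auto simp: pool_def)
qed

section \<open>Contraction over one round\<close>

lemma abs_expectation_diff_le:
  fixes g :: "'a \<Rightarrow> real"
  assumes "\<And>x. x \<in> set_pmf p \<Longrightarrow> \<bar>g x - a\<bar> \<le> b"
  shows "\<bar>measure_pmf.expectation p g - a\<bar> \<le> b"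
proof -
  have bnd: "\<bar>g x\<bar> \<le> \<bar>a\<bar> + b" if "x \<in> set_pmf p" for x
    using assms[OF that] by linarith
  then have "integrable (measure_pmf p) g"
    by (intro measure_pmf.integrable_const_bound[where B = "\<bar>a\<bar> + b"]) (auto simp: AE_measure_pmf_iff)
  then have "measure_pmf.expectation p g - a = measure_pmf.expectation p (\<lambda>x. g x - a)"
    by simp
  also have "\<bar>\<dots>\<bar> \<le> measure_pmf.expectation p (\<lambda>x. \<bar>g x - a\<bar>)"
    by (rule integral_abs_bound)
  also have "\<dots> \<le> b"
    using \<open>integrable (measure_pmf p) g\<close> assms
    by (intro measure_pmf.integral_le_const) (auto simp: AE_measure_pmf_iff)
  finally show ?thesis .
qed

lemma finite_panels: "finite (panels I)"
  by (rule finite_subset[of _ "Pow (pool I)"]) (auto simp: panels_def pool_def)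

text \<open>Here \<open>c Q\<close> stands for the probability of ending with \<open>P\<close> after
  a round that drew the non-panel \<open>Q\<close>. As panels are equally likely, stopping
  contributes no net deviation from the uniform value; continuing deviates by at most
  \<open>B\<close>, on an event whose probability is at most the stated factor.\<close>

lemma round_contraction:
  fixes c :: "nat set \<Rightarrow> real"
  assumes inst: "sortition_instance I" "F' \<subseteq> features I" "f0 \<in> F'" and P: "P \<in> panels I"
    and c: "\<And>Q. \<bar>c Q - 1 / card (panels I)\<bar> \<le> B"
  shows "\<bar>measure_pmf.expectation (sampler I F' f0)
            (\<lambda>Q. if Q \<in> panels I then of_bool (Q = P) else c Q) - 1 / card (panels I)\<bar>
         \<le> (1 - 1 / 2 ^ pool_size I) * B"
proof -
  let ?s = "pmf (sampler I F' f0)" and ?N = "Pow (pool I)" and ?a = "1 / real (card (panels I))"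
  let ?g = "\<lambda>Q. if Q \<in> panels I then of_bool (Q = P) else c Q"
  have finN: "finite ?N" by (simp add: pool_def)
  have sub: "panels I \<subseteq> ?N" by (auto simp: panels_def)
  have m: "card (panels I) > 0" using P finite_panels by (auto simp: card_gt_0_iff)
  have "B \<ge> 0" using c[of P] by linarith
  have one: "(\<Sum>Q\<in>?N. ?s Q) = 1"
    using finN set_pmf_sampler by (rule sum_pmf_eq_1)
  have "measure_pmf.expectation (sampler I F' f0) ?g = (\<Sum>Q\<in>?N. ?s Q * ?g Q)"
    using set_pmf_sampler[of I F' f0]
    by (subst integral_measure_pmf_real[OF finN]) (auto simp: mult.commute intro!: sum.cong)
  \<comment> \<open>The masses sum to 1, so \<open>?a\<close> can be moved under the sum.\<close>
  then have "measure_pmf.expectation (sampler I F' f0) ?g - ?a = (\<Sum>Q\<in>?N. ?s Q * (?g Q - ?a))"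
    using one by (simp add: right_diff_distrib sum_subtractf flip: sum_distrib_right sum_divide_distrib)
  also have "\<dots> = (\<Sum>Q\<in>?N - panels I. ?s Q * (?g Q - ?a)) + (\<Sum>Q\<in>panels I. ?s Q * (?g Q - ?a))"
    by (rule sum.subset_diff[OF sub finN])
  also have "(\<Sum>Q\<in>panels I. ?s Q * (?g Q - ?a)) = (\<Sum>Q\<in>panels I. ?s P * (of_bool (Q = P) - ?a))"
    using pmf_sampler_panel[OF inst] P by (intro sum.cong) auto
  \<comment> \<open>Over the panels both the indicator of \<open>P\<close> and the constant
    \<open>?a\<close> sum to 1.\<close>
  also have "\<dots> = 0"
    using m P finite_panels[of I]
    by (auto simp: sum_subtractf of_bool_def simp flip: sum_distrib_left)
  also have "(\<Sum>Q\<in>?N - panels I. ?s Q * (?g Q - ?a)) = (\<Sum>Q\<in>?N - panels I. ?s Q * (c Q - ?a))"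
    by (intro sum.cong) auto
  finally have "\<bar>measure_pmf.expectation (sampler I F' f0) ?g - ?a\<bar> =
      \<bar>\<Sum>Q\<in>?N - panels I. ?s Q * (c Q - ?a)\<bar>" by simp
  also have "\<dots> \<le> (\<Sum>Q\<in>?N - panels I. ?s Q * B)"
    by (rule order_trans[OF sum_abs]) (intro sum_mono, simp add: abs_mult mult_left_mono c)
  also have "\<dots> = (\<Sum>Q\<in>?N - panels I. ?s Q) * B"
    by (simp add: sum_distrib_right)
  also have "\<dots> \<le> (1 - 1 / 2 ^ pool_size I) * B"
  proof (intro mult_right_mono \<open>B \<ge> 0\<close>)
    \<comment> \<open>Keeping the single panel \<open>P\<close> as stopping event already gives a
      sufficient bound.\<close>
    have "(\<Sum>Q\<in>?N - panels I. ?s Q) \<le> (\<Sum>Q\<in>?N - {P}. ?s Q)"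
      using finN P by (intro sum_mono2) auto
    also have "\<dots> = 1 - ?s P"
      using one P sub finN by (subst sum_diff1) auto
    finally show "(\<Sum>Q\<in>?N - panels I. ?s Q) \<le> 1 - 1 / 2 ^ pool_size I"
      using pmf_sampler_panel_ge[OF inst P] by linarith
  qed
  finally show ?thesis .
qed

section \<open>Probability of a fixed panel as a function of the history\<close>

lemma spmf_max_entropy:
  assumes "P \<in> panels I"
  shows "spmf (max_entropy I anchor pick h) P =
    measure_pmf.expectation (pick h) (\<lambda>F'.
      measure_pmf.expectation (sampler I F' (anchor F')) (\<lambda>Q.
        if Q \<in> panels I then of_bool (Q = P)
        else spmf (max_entropy I anchor pick (h @ [(F', Q)])) P))"
proof -
  have "spmf (if Q \<in> panels I then return_spmf Q else max_entropy I anchor pick (h @ [(F', Q)])) P =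
    (if Q \<in> panels I then of_bool (Q = P) else spmf (max_entropy I anchor pick (h @ [(F', Q)])) P)" for F' Q
    by (simp add: indicator_def)
  then show ?thesis
    by (subst max_entropy.simps) (simp add: pmf_bind)
qed

theorem theorem3p3:
  fixes I :: "'v sortition"
    and anchor :: "(nat \<Rightarrow> 'v) set \<Rightarrow> (nat \<Rightarrow> 'v)"
    and pick :: "'v history \<Rightarrow> (nat \<Rightarrow> 'v) set pmf"
  assumes "sortition_instance I"
    and "panels I \<noteq> {}"
    and "\<And>F'. F' \<noteq> {} \<Longrightarrow> F' \<subseteq> features I \<Longrightarrow> anchor F' \<in> F'"
    and "\<And>h F'. F' \<in> set_pmf (pick h) \<Longrightarrow> F' \<noteq> {} \<and> F' \<subseteq> features I"
  shows "\<forall>P\<in>panels I. spmf (max_entropy I anchor pick []) P = 1 / real (card (panels I))"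
proof
  fix P assume P: "P \<in> panels I"
  define r :: real where "r = 1 - 1 / 2 ^ pool_size I"
  have r: "0 \<le> r" "r < 1" by (auto simp: r_def)
  \<comment> \<open>The exponent \<open>j\<close> counts unfolded rounds; \<open>h\<close> stays
    arbitrary because each round extends the history.\<close>
  have bound: "\<bar>spmf (max_entropy I anchor pick h) P - 1 / card (panels I)\<bar> \<le> r ^ j" for h j
  proof (induction j arbitrary: h)
    case 0
    \<comment> \<open>Two numbers in the unit interval differ by at most
      \<open>r ^ 0 = 1\<close>.\<close>
    have "0 \<le> 1 / real (card (panels I))" "1 / real (card (panels I)) \<le> 1"
      by (auto simp: divide_le_eq)
    then show ?case
      using pmf_nonneg[of "max_entropy I anchor pick h" "Some P"]
        pmf_le_1[of "max_entropy I anchor pick h" "Some P"]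
      unfolding power_0 by linarith
  next
    case (Suc j)
    show ?case
      unfolding spmf_max_entropy[OF P, of anchor pick h] power_Suc
    \<comment> \<open>A bound valid for every feature subset in the support of \<open>pick h\<close>
      survives averaging over the choice.\<close>
    proof (rule abs_expectation_diff_le)
      fix F' assume "F' \<in> set_pmf (pick h)"
      from assms(4)[OF this] have "F' \<subseteq> features I" "anchor F' \<in> F'"
        by (auto intro: assms(3))
      \<comment> \<open>The continuation values at the histories \<open>h @ [(F', Q)]\<close> serve
        as \<open>c Q\<close>, with \<open>B = r ^ j\<close> from the induction hypothesis.\<close>
      then show "\<bar>measure_pmf.expectation (sampler I F' (anchor F')) (\<lambda>Q.
          if Q \<in> panels I then of_bool (Q = P)
          else spmf (max_entropy I anchor pick (h @ [(F', Q)])) P) - 1 / card (panels I)\<bar> \<le> r * r ^ j"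
        unfolding r_def using assms(1) P Suc.IH[unfolded r_def] by (intro round_contraction)
    qed
  qed
  \<comment> \<open>The deviation does not depend on \<open>j\<close>, so letting \<open>j\<close>
    grow forces it to vanish.\<close>
  have "(\<lambda>j. r ^ j) \<longlonglongrightarrow> 0"
    using r by (intro LIMSEQ_realpow_zero)
  then have "\<bar>spmf (max_entropy I anchor pick []) P - 1 / card (panels I)\<bar> \<le> 0"
    by (rule LIMSEQ_le_const) (simp add: bound)
  then show "spmf (max_entropy I anchor pick []) P = 1 / real (card (panels I))"
    by simp
qed

end
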